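(* Let $\mathscr{A}$ be a closed set of impartial games with misère quotient $(\mathcal{Q},\mathcal{P})$, quotient map $\Phi$, and transition algebra $T=T(\mathscr{A})$. Let $G$ be a game that has at least one option, with every option of $G$ lying in $\mathscr{A}$, and put $\mathscr{B}=\mathrm{cl}(\mathscr{A}\cup\{G\})$. For $x\in\mathcal{Q}$ the following are equivalent: (a) $\mathcal{Q}(\mathscr{B})\cong\mathcal{Q}(\mathscr{A})$ and $\Phi(G)=x$; precisely: for $K,K'\in\mathscr{A}$ one has $K\equiv_{\mathscr{A}}K'$ iff $K\equiv_{\mathscr{B}}K'$, every element of $\mathscr{B}$ is $\equiv_{\mathscr{B}}$-equivalent to an element of $\mathscr{A}$, and $G\equiv_{\mathscr{B}}H$ for every $H\in\mathscr{A}$ with $\Phi(H)=x$. (b) Both of the following hold: (i) $\Phi''G\subseteq\mathcal{M}_x$; and (ii) for each $(y,\mathcal{E})\in T$ and each integer $n\ge 0$ such that $x^{n+1}y\notin\mathcal{P}$, either $x^{n+1}y'\in\mathcal{P}$ for some $y'\in\mathcal{E}$, or $x^nx'y\in\mathcal{P}$ for some $x'\in\Phi''G$.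
   Context: All games are impartial; $G+H$ is the disjunctive sum, $n\cdot G$ the sum of $n$ copies of $G$. In misère play the last player to move loses; $o^-(G)\in\{\mathscr{P},\mathscr{N}\}$ is the misère outcome ($\mathscr{P}$ if the player not to move can force a win). A set of games is closed if it is closed under disjunctive sum and under taking options; $\mathrm{cl}(\mathscr{S})$ is the smallest closed set containing $\mathscr{S}$. For closed $\mathscr{C}$ and $G,H\in\mathscr{C}$, $G\equiv_{\mathscr{C}}H$ iff $o^-(G+X)=o^-(H+X)$ for all $X\in\mathscr{C}$; $\mathcal{Q}(\mathscr{C})=(\mathscr{C}/\equiv_{\mathscr{C}},\mathcal{P})$ with $\mathcal{P}$ the set of classes of misère $\mathscr{P}$-positions is the misère quotient (a commutative monoid with distinguished subset), and $\Phi:\mathscr{A}\to\mathcal{Q}$ is the quotient map for $\mathscr{A}$. For a game $G$ whose options lie in $\mathscr{A}$, $\Phi''G=\{\Phi(G'):G' \text{ an option of } G\}$. The meximal set of $x\in\mathcal{Q}$ is $\mathcal{M}_x=\{y\in\mathcal{Q}:\text{there is no } w\in\mathcal{Q}\text{ with both } xw\in\mathcal{P},\ yw\in\mathcal{P}\}$. The transition algebra of $\mathscr{A}$ is $T(\mathscr{A})=\{(\Phi(K),\Phi''K):K\in\mathscr{A}\}$. *)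

theory Defs
  imports HOL.Hull "HOL-Library.FSet" "HOL-Algebra.Group"
begin

text \<open>
  Impartial games are finite and loop-free, and a game is identified with its set of options
  (hereditarily finite sets).
\<close>

datatype game = Game (options: "game fset")

lemma size_option: "G' |\<in>| options G \<Longrightarrow> size G' < size G"
proof (cases G)
  case (Game S)
  assume "G' |\<in>| options G"
  then have "G' \<in> fset S" using Game by simp
  then have "Suc (size G') \<le> (\<Sum>x\<in>fset S. Suc (size x))"
    by (intro member_le_sum) auto
  then show ?thesis using Game by simp
qed

lemma game_induct [case_names options]:
  assumes "\<And>G. (\<And>G'. G' |\<in>| options G \<Longrightarrow> P G') \<Longrightarrow> P G"
  shows "P G"
  by (induction G rule: measure_induct_rule[of size]) (use assms size_option in blast)

instantiation game :: "{zero, plus}"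
begin

definition zero_game :: game where
  "zero_game = Game {||}"

function plus_game :: "game \<Rightarrow> game \<Rightarrow> game" where
  "plus_game G H =
     Game ((\<lambda>G'. plus_game G' H) |`| options G |\<union>| (\<lambda>H'. plus_game G H') |`| options H)"
  by pat_completeness auto
termination
  by (relation "measure (\<lambda>(G, H). size G + size H)") (auto dest: size_option)

instance ..

end

declare plus_game.simps [simp del]

lemma options_zero [simp]: "options (0::game) = {||}"
  by (simp add: zero_game_def)

lemma options_plus:
  "options (G + H) = (\<lambda>G'. G' + H) |`| options G |\<union>| (\<lambda>H'. G + H') |`| options H"
  for G H :: game
  by (subst plus_game.simps) simp

lemma fset_options_plus:
  "fset (options (G + H)) = (\<lambda>G'. G' + H) ` fset (options G) \<union> (\<lambda>H'. G + H') ` fset (options H)"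
  for G H :: game
  by (simp add: options_plus)

lemma game_eqI: "fset (options G) = fset (options H) \<Longrightarrow> G = H"
  by (simp add: fset_inject game.expand)

lemma game_add_commute: "G + H = H + G" for G H :: game
proof (induction "size G + size H" arbitrary: G H rule: less_induct)
  case less
  have "(\<lambda>G'. G' + H) ` fset (options G) = (\<lambda>G'. H + G') ` fset (options G)"
    by (rule image_cong[OF refl], rule less) (use size_option in simp)
  moreover have "(\<lambda>H'. G + H') ` fset (options H) = (\<lambda>H'. H' + G) ` fset (options H)"
    by (rule image_cong[OF refl], rule less) (use size_option in simp)
  ultimately show ?case
    by (intro game_eqI) (simp only: fset_options_plus Un_commute)
qed

lemma game_add_zero: "0 + G = G" for G :: game
proof (induction G rule: game_induct)
  case (options G)
  have "(\<lambda>G'. 0 + G') ` fset (options G) = fset (options G)"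
    using options by simp
  then show ?case
    by (intro game_eqI) (simp add: fset_options_plus)
qed

lemma game_add_assoc: "(G + H) + K = G + (H + K)" for G H K :: game
proof (induction "size G + size H + size K" arbitrary: G H K rule: less_induct)
  case less
  have 1: "(\<lambda>G'. (G' + H) + K) ` fset (options G) = (\<lambda>G'. G' + (H + K)) ` fset (options G)"
    by (rule image_cong[OF refl], rule less) (use size_option in simp)
  have 2: "(\<lambda>H'. (G + H') + K) ` fset (options H) = (\<lambda>H'. G + (H' + K)) ` fset (options H)"
    by (rule image_cong[OF refl], rule less) (use size_option in simp)
  have 3: "(\<lambda>K'. (G + H) + K') ` fset (options K) = (\<lambda>K'. G + (H + K')) ` fset (options K)"
    by (rule image_cong[OF refl], rule less) (use size_option in simp)
  show ?case
    by (intro game_eqI) (simp only: fset_options_plus image_Un image_image 1 2 3 Un_assoc)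
qed

instance game :: comm_monoid_add
  by standard (fact game_add_assoc game_add_commute game_add_zero)+

datatype outcome = PPos | NPos

text \<open>
  In misere play, a player who is to move in a game without options has won, since the opponent
  made the last move; hence the clause \<open>options G \<noteq> {||}\<close>.
\<close>

function misere_outcome :: "game \<Rightarrow> outcome" where
  "misere_outcome G =
     (if options G \<noteq> {||} \<and> (\<forall>G' \<in> fset (options G). misere_outcome G' = NPos) then PPos else NPos)"
  by pat_completeness auto
termination
  by (relation "measure size") (auto dest: size_option)

declare misere_outcome.simps [simp del]

definition closed_games :: "game set \<Rightarrow> bool" where
  "closed_games C \<longleftrightarrow>
     (\<forall>G\<in>C. \<forall>H\<in>C. G + H \<in> C) \<and> (\<forall>G\<in>C. fset (options G) \<subseteq> C)"

definition cl :: "game set \<Rightarrow> game set" where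
  "cl S = closed_games hull S"

lemma closed_games_cl: "closed_games (cl S)"
  unfolding cl_def by (rule hull_in, unfold closed_games_def) blast

definition misere_equiv :: "game set \<Rightarrow> game rel" where
  "misere_equiv C = {(G, H). G \<in> C \<and> H \<in> C \<and>
     (\<forall>X\<in>C. misere_outcome (G + X) = misere_outcome (H + X))}"

text \<open>The quotient map \<open>\<Phi>\<close>; meaningful for arguments in \<open>C\<close>.\<close>

definition quot_map :: "game set \<Rightarrow> game \<Rightarrow> game set" where
  "quot_map C G = misere_equiv C `` {G}"

text \<open>
  The product of two classes is the class of the sum of any representatives; for closed \<open>C\<close> all
  members of the union below coincide (lemma \<open>mult_quot_map\<close>).
\<close>

definition misere_quotient :: "game set \<Rightarrow> game set monoid" where
  "misere_quotient C =
     \<lparr>carrier = C // misere_equiv C,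
      mult = (\<lambda>x y. \<Union>K\<in>x. \<Union>L\<in>y. quot_map C (K + L)),
      one = quot_map C 0\<rparr>"

definition P_portion :: "game set \<Rightarrow> game set set" where
  "P_portion C = {quot_map C K | K. K \<in> C \<and> misere_outcome K = PPos}"

definition option_classes :: "game set \<Rightarrow> game \<Rightarrow> game set set" where
  "option_classes C G = quot_map C ` fset (options G)"

definition meximal_set :: "game set \<Rightarrow> game set \<Rightarrow> game set set" where
  "meximal_set C x =
     {y \<in> carrier (misere_quotient C).
        \<not> (\<exists>w \<in> carrier (misere_quotient C).
             x \<otimes>\<^bsub>misere_quotient C\<^esub> w \<in> P_portion C \<and> y \<otimes>\<^bsub>misere_quotient C\<^esub> w \<in> P_portion C)}"

definition transition_algebra :: "game set \<Rightarrow> (game set \<times> game set set) set" where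
  "transition_algebra C = {(quot_map C K, option_classes C K) | K. K \<in> C}"

lemma equiv_misere_equiv: "equiv C (misere_equiv C)"
  by (auto simp: equiv_def refl_on_def sym_def trans_def misere_equiv_def)

lemma zero_in_closed:
  assumes "closed_games C" "C \<noteq> {}"
  shows "0 \<in> C"
proof -
  have "G \<in> C \<Longrightarrow> 0 \<in> C" for G
  proof (induction G rule: game_induct)
    case (options G)
    show ?case
    proof (cases "options G = {||}")
      case True
      then have "G = 0" by (simp add: game.expand)
      then show ?thesis using options by simp
    next
      case False
      then obtain G' where "G' |\<in>| options G" by blast
      then show ?thesis using options assms(1) unfolding closed_games_def by blast
    qed
  qed
  then show ?thesis using assms(2) by blast
qed

lemma quot_map_eq_iff:
  "K \<in> C \<Longrightarrow> L \<in> C \<Longrightarrow> quot_map C K = quot_map C L \<longleftrightarrow> (K, L) \<in> misere_equiv C"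
  unfolding quot_map_def by (rule eq_equiv_class_iff[OF equiv_misere_equiv])

lemma mult_quot_map:
  assumes C: "closed_games C" and K: "K \<in> C" and L: "L \<in> C"
  shows "quot_map C K \<otimes>\<^bsub>misere_quotient C\<^esub> quot_map C L = quot_map C (K + L)"
proof -
  have sum: "(K' + L', K + L) \<in> misere_equiv C"
    if "(K, K') \<in> misere_equiv C" "(L, L') \<in> misere_equiv C" for K' L'
  proof -
    have in_C: "K' \<in> C" "L' \<in> C" using that by (auto simp: misere_equiv_def)
    have "misere_outcome (K' + L' + X) = misere_outcome (K + L + X)" if X: "X \<in> C" for X
    proof -
      have "L' + X \<in> C" "K + X \<in> C" using C X K in_C by (auto simp: closed_games_def)
      then have "misere_outcome (K' + (L' + X)) = misere_outcome (K + (L' + X))"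
        and "misere_outcome (L' + (K + X)) = misere_outcome (L + (K + X))"
        using \<open>(K, K') \<in> _\<close> \<open>(L, L') \<in> _\<close> by (auto simp: misere_equiv_def)
      then show ?thesis by (simp add: ac_simps)
    qed
    then show ?thesis using C K L in_C by (auto simp: misere_equiv_def closed_games_def)
  qed
  have "quot_map C (K' + L') = quot_map C (K + L)"
    if "K' \<in> quot_map C K" "L' \<in> quot_map C L" for K' L'
    using sum[of K' L'] that unfolding quot_map_def
    by (simp add: equiv_class_eq[OF equiv_misere_equiv])
  moreover have "K \<in> quot_map C K" "L \<in> quot_map C L"
    using K L unfolding quot_map_def by (simp_all add: misere_equiv_def)
  ultimately have "(\<Union>K'\<in>quot_map C K. \<Union>L'\<in>quot_map C L. quot_map C (K' + L')) = quot_map C (K + L)"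
    by blast
  then show ?thesis by (simp add: misere_quotient_def)
qed

lemma carrier_misere_quotient: "carrier (misere_quotient C) = quot_map C ` C"
  unfolding misere_quotient_def quotient_def quot_map_def by (simp add: UNION_singleton_eq_range)

lemma comm_monoid_misere_quotient:
  assumes C: "closed_games C" and ne: "C \<noteq> {}"
  shows "comm_monoid (misere_quotient C)"
proof -
  have z: "0 \<in> C" by (rule zero_in_closed[OF C ne])
  have one: "\<one>\<^bsub>misere_quotient C\<^esub> = quot_map C 0" by (simp add: misere_quotient_def)
  have s: "K + L \<in> C" if "K \<in> C" "L \<in> C" for K L
    using C that by (simp add: closed_games_def)
  note [simp] = carrier_misere_quotient one mult_quot_map[OF C]
  show ?thesis
  proof (rule comm_monoidI)
    fix x y z
    assume "x \<in> carrier (misere_quotient C)" "y \<in> carrier (misere_quotient C)"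
      "z \<in> carrier (misere_quotient C)"
    then show "x \<otimes>\<^bsub>misere_quotient C\<^esub> y \<otimes>\<^bsub>misere_quotient C\<^esub> z =
        x \<otimes>\<^bsub>misere_quotient C\<^esub> (y \<otimes>\<^bsub>misere_quotient C\<^esub> z)"
      by (auto simp: s add.assoc)
  next
    fix x y
    assume "x \<in> carrier (misere_quotient C)" "y \<in> carrier (misere_quotient C)"
    then show "x \<otimes>\<^bsub>misere_quotient C\<^esub> y = y \<otimes>\<^bsub>misere_quotient C\<^esub> x"
      by (auto simp: add.commute)
  qed (use s z in auto)
qed

lemma quot_map_in_P_portion:
  assumes "closed_games C" "K \<in> C"
  shows "quot_map C K \<in> P_portion C \<longleftrightarrow> misere_outcome K = PPos"
proof -
  have z: "0 \<in> C" using zero_in_closed assms by blast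
  have "misere_outcome K = misere_outcome L"
    if "L \<in> C" "quot_map C K = quot_map C L" for L
  proof -
    have "(K, L) \<in> misere_equiv C" using that assms(2) quot_map_eq_iff by blast
    then have "misere_outcome (K + 0) = misere_outcome (L + 0)"
      using z unfolding misere_equiv_def by blast
    then show ?thesis by simp
  qed
  then show ?thesis using assms(2) unfolding P_portion_def mem_Collect_eq by metis
qed

end

theory Submission
  imports Defs
begin

text \<open>
  Let \<open>H\<close> represent \<open>x\<close>. The members of \<open>B\<close> are the sums \<open>n \<cdot> G + K\<close> with \<open>K \<in> A\<close>, and both (a) and (b)
  amount to the statement that \<open>n \<cdot> G + K\<close> and \<open>n \<cdot> H + K\<close> always have the same outcome. From (b) this
  follows by induction on \<open>n\<close> and then on \<open>K\<close>: condition (i) says that no move \<open>G \<rightarrow> G'\<close> spoils a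
  \<open>\<P>\<close>-position, and (ii) supplies a winning move in every \<open>\<N>\<close>-position.
\<close>

section \<open>Outcomes, closed sets and sums of copies of a game\<close>

lemma misere_PPos_iff:
  "misere_outcome G = PPos \<longleftrightarrow>
     options G \<noteq> {||} \<and> (\<forall>G' \<in> fset (options G). misere_outcome G' \<noteq> PPos)"
  by (subst misere_outcome.simps) (auto intro: outcome.exhaust)

lemma outcome_eq_iff: "(o1 = o2) \<longleftrightarrow> (o1 = PPos \<longleftrightarrow> o2 = PPos)"
  by (cases o1; cases o2) auto

lemma closed_games_add: "closed_games C \<Longrightarrow> G \<in> C \<Longrightarrow> H \<in> C \<Longrightarrow> G + H \<in> C"
  by (simp add: closed_games_def)

lemma closed_games_option:
  "closed_games C \<Longrightarrow> G \<in> C \<Longrightarrow> G' \<in> fset (options G) \<Longrightarrow> G' \<in> C"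
  by (auto simp: closed_games_def)

primrec copies :: "nat \<Rightarrow> game \<Rightarrow> game" where
  "copies 0 G = 0"
| "copies (Suc n) G = G + copies n G"

lemma copies_add: "copies (m + n) G = copies m G + copies n G"
  by (induction m) (simp_all add: add.assoc)

lemma copies_in_closed:
  assumes "closed_games C" "G \<in> C"
  shows "copies n G \<in> C"
proof (induction n)
  case 0
  have "0 \<in> C" using zero_in_closed assms by blast
  then show ?case by simp
next
  case (Suc n)
  then show ?case using assms closed_games_add by simp
qed

text \<open>By commutativity it does not matter in which copy the move is made: \<open>n\<close>
  untouched copies remain. The form with \<open>Suc n\<close> avoids a subtraction.\<close>

lemma options_copies_Suc:
  "fset (options (copies (Suc n) G)) = (\<lambda>G'. copies n G + G') ` fset (options G)"
proof (induction n)
  case 0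
  then show ?case by (simp add: fset_options_plus)
next
  case (Suc n)
  have "fset (options (copies (Suc (Suc n)) G)) =
      (\<lambda>G'. G' + copies (Suc n) G) ` fset (options G) \<union>
      (\<lambda>X. G + X) ` (\<lambda>G'. copies n G + G') ` fset (options G)"
    by (subst copies.simps(2)) (simp only: fset_options_plus Suc)
  also have "\<dots> = (\<lambda>G'. copies (Suc n) G + G') ` fset (options G)"
    by (simp add: image_image ac_simps)
  finally show ?case .
qed

lemma options_copies_plus:
  "fset (options (copies (Suc n) G + K)) =
     (\<lambda>G'. copies n G + (G' + K)) ` fset (options G) \<union>
     (\<lambda>K'. copies (Suc n) G + K') ` fset (options K)"
  by (simp only: fset_options_plus options_copies_Suc image_image add.assoc)

text \<open>The copies are exchanged one at a time. Those not being exchanged are absorbed into the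
  test game, which stays in \<open>C\<close> because \<open>C\<close> is closed.\<close>

lemma misere_equiv_copies:
  assumes C: "closed_games C" and GH: "(G, H) \<in> misere_equiv C" and X: "X \<in> C"
  shows "misere_outcome (copies n G + X) = misere_outcome (copies n H + X)"
  using X
proof (induction n arbitrary: X)
  case (Suc n)
  have G: "G \<in> C" and H: "H \<in> C" using GH by (auto simp: misere_equiv_def)
  have "copies n H + X \<in> C"
    using copies_in_closed C H Suc.prems closed_games_add by blast
  then have "misere_outcome (G + (copies n H + X)) = misere_outcome (H + (copies n H + X))"
    using GH by (simp add: misere_equiv_def)
  moreover have "misere_outcome (copies n G + (G + X)) = misere_outcome (copies n H + (G + X))"
    using Suc.IH closed_games_add[OF C G Suc.prems] .
  ultimately show ?case by (simp add: ac_simps)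
qed simp

text \<open>A move in a copy of \<open>G\<close> leaves one copy fewer and an option of
  \<open>G\<close>, which lies in \<open>A\<close> and merges with \<open>K\<close>; so these sums
  are closed under options.\<close>

lemma cl_insert:
  assumes A: "closed_games A" and ne: "A \<noteq> {}" and G: "fset (options G) \<subseteq> A"
  shows "cl (A \<union> {G}) = {copies n G + K | n K. K \<in> A}" (is "_ = ?S")
  unfolding cl_def
proof (rule hull_unique)
  have "0 \<in> A" using zero_in_closed A ne .
  then have "copies (Suc 0) G + 0 \<in> ?S" by blast
  moreover have "K \<in> ?S" if "K \<in> A" for K
  proof -
    have "K = copies 0 G + K" by simp
    then show ?thesis using that by blast
  qed
  ultimately show "A \<union> {G} \<subseteq> ?S" by auto
next
  show "closed_games ?S"
    unfolding closed_games_def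
  proof (intro conjI ballI subsetI)
    fix X Y assume "X \<in> ?S" "Y \<in> ?S"
    then obtain m K n L where "X = copies m G + K" "Y = copies n G + L" "K \<in> A" "L \<in> A"
      by blast
    then have "X + Y = copies (m + n) G + (K + L)" "K + L \<in> A"
      using A closed_games_add by (simp_all add: copies_add ac_simps)
    then show "X + Y \<in> ?S" by blast
  next
    fix X Y assume "X \<in> ?S" and Y: "Y \<in> fset (options X)"
    then obtain n K where X: "X = copies n G + K" and K: "K \<in> A" by blast
    show "Y \<in> ?S"
    proof (cases n)
      case 0
      then have "Y = copies 0 G + Y" "Y \<in> A"
        using closed_games_option[OF A K] X Y by auto
      then show ?thesis by blast
    next
      case (Suc k)
      then show ?thesis
        using Y closed_games_add[OF A _ K] closed_games_option[OF A K] G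
        unfolding X Suc options_copies_plus by blast
    qed
  qed
next
  fix C assume AG: "A \<union> {G} \<subseteq> C" and C: "closed_games C"
  then show "?S \<subseteq> C"
    using copies_in_closed[OF C] closed_games_add[OF C] by blast
qed

section \<open>Powers of a class, and the comparison of \<open>n\<close> copies of \<open>G\<close>
  with \<open>n\<close> copies of \<open>H\<close>\<close>

lemma quot_map_pow:
  assumes C: "closed_games C" and H: "H \<in> C"
  shows "quot_map C H [^]\<^bsub>misere_quotient C\<^esub> n = quot_map C (copies n H)"
proof -
  have "C \<noteq> {}" using H by blast
  with C interpret comm_monoid "misere_quotient C"
    by (rule comm_monoid_misere_quotient)
  show ?thesis
  proof (induction n)
    case 0
    then show ?case by (simp add: misere_quotient_def)
  next
    case (Suc n)
    then show ?case
      using mult_quot_map[OF C copies_in_closed[OF C H] H] by (simp add: add.commute)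
  qed
qed

text \<open>The right side is (i) and (ii) with classes replaced by representatives. No option of
  \<open>H\<close> occurs in it: moves in a copy of \<open>H\<close> are never matched with moves in
  a copy of \<open>G\<close>.\<close>

lemma same_outcome_iff:
  assumes A: "closed_games A" and ne: "options G \<noteq> {||}" and G: "fset (options G) \<subseteq> A"
    and H: "H \<in> A"
  shows
    "(\<forall>n. \<forall>K\<in>A. misere_outcome (copies n G + K) = misere_outcome (copies n H + K)) \<longleftrightarrow>
     (\<forall>G'\<in>fset (options G). \<forall>W\<in>A.
        misere_outcome (H + W) = PPos \<longrightarrow> misere_outcome (G' + W) \<noteq> PPos) \<and>
     (\<forall>K\<in>A. \<forall>n. misere_outcome (copies (Suc n) H + K) \<noteq> PPos \<longrightarrow>
        (\<exists>K'\<in>fset (options K). misere_outcome (copies (Suc n) H + K') = PPos) \<or>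
        (\<exists>G'\<in>fset (options G). misere_outcome (copies n H + (G' + K)) = PPos))"
    (is "?same \<longleftrightarrow> ?mex \<and> ?move")
proof
  assume same: ?same
  have ?mex
  proof (intro ballI impI)
    fix G' W assume G': "G' \<in> fset (options G)" and W: "W \<in> A"
      and "misere_outcome (H + W) = PPos"
    then have "misere_outcome (G + W) = PPos"
      using same[rule_format, of W "Suc 0"] by simp
    moreover have "G' + W \<in> fset (options (G + W))"
      using G' by (simp add: fset_options_plus)
    ultimately show "misere_outcome (G' + W) \<noteq> PPos"
      unfolding misere_PPos_iff[of "G + W"] by blast
  qed
  moreover have ?move
  proof (intro ballI allI impI)
    fix K n assume K: "K \<in> A" and "misere_outcome (copies (Suc n) H + K) \<noteq> PPos"
    then have "misere_outcome (copies (Suc n) G + K) \<noteq> PPos"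
      using same by metis
    \<comment> \<open>In misere play a game without options is an N-position with no move to a
      P-position; the option of \<open>G\<close> excludes this case.\<close>
    moreover have "fset (options (copies (Suc n) G + K)) \<noteq> {}"
      unfolding options_copies_plus using ne by auto
    ultimately obtain X where "X \<in> fset (options (copies (Suc n) G + K))"
      and "misere_outcome X = PPos"
      using misere_PPos_iff[of "copies (Suc n) G + K"] by auto
    then consider
      K' where "K' \<in> fset (options K)" "misere_outcome (copies (Suc n) G + K') = PPos"
      | G' where "G' \<in> fset (options G)" "misere_outcome (copies n G + (G' + K)) = PPos"
      unfolding options_copies_plus by blast
    then show "(\<exists>K'\<in>fset (options K). misere_outcome (copies (Suc n) H + K') = PPos) \<or>
        (\<exists>G'\<in>fset (options G). misere_outcome (copies n H + (G' + K)) = PPos)"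
    proof cases
      case 1
      then show ?thesis using same closed_games_option[OF A K] by metis
    next
      case 2
      then have "G' + K \<in> A" using closed_games_add[OF A] G K by blast
      then show ?thesis using same 2 by metis
    qed
  qed
  ultimately show "?mex \<and> ?move" ..
next
  assume *: "?mex \<and> ?move"
  have "misere_outcome (copies n G + K) = misere_outcome (copies n H + K)" if "K \<in> A" for n K
    using that
  proof (induction n arbitrary: K)
    case (Suc n)
    \<comment> \<open>A move in \<open>G\<close> drops to \<open>n\<close> copies but changes the
      other summand to \<open>G' + K\<close>, so this hypothesis is kept for all of
      \<open>A\<close>. A move in \<open>K\<close> keeps \<open>Suc n\<close> copies and calls for
      the inner induction.\<close>
    note IH_n = Suc.IH
    show ?case using Suc.prems
    proof (induction K rule: game_induct)
      case (options K)
      note K = options.prems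
      have IH_G': "misere_outcome (copies n G + (G' + K)) = misere_outcome (copies n H + (G' + K))"
        if "G' \<in> fset (options G)" for G'
        using IH_n closed_games_add[OF A _ K] G that by blast
      have IH_K': "misere_outcome (copies (Suc n) G + K') = misere_outcome (copies (Suc n) H + K')"
        if "K' \<in> fset (options K)" for K'
        using options.IH[OF that] closed_games_option[OF A K that] by blast
      \<comment> \<open>Both induction hypotheses together express the outcome through games with
        copies of \<open>H\<close>, to which (i) and (ii) apply.\<close>
      have PPos_iff: "misere_outcome (copies (Suc n) G + K) = PPos \<longleftrightarrow>
          (\<forall>G'\<in>fset (options G). misere_outcome (copies n H + (G' + K)) \<noteq> PPos) \<and>
          (\<forall>K'\<in>fset (options K). misere_outcome (copies (Suc n) H + K') \<noteq> PPos)"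
      proof -
        have "fset (options (copies (Suc n) G + K)) \<noteq> {}"
          unfolding options_copies_plus using ne by auto
        then have "options (copies (Suc n) G + K) \<noteq> {||}" by auto
        then show ?thesis
          unfolding misere_PPos_iff[of "copies (Suc n) G + K"] options_copies_plus
          using IH_G' IH_K' by (simp add: ball_Un del: copies.simps)
      qed
      show ?case
      proof (cases "misere_outcome (copies (Suc n) H + K) = PPos")
        case True
        \<comment> \<open>Condition (i) is used with the remaining \<open>n\<close> copies of
          \<open>H\<close>, together with \<open>K\<close>, as test game.\<close>
        have W: "copies n H + K \<in> A"
          using copies_in_closed[OF A H] closed_games_add[OF A] K by blast
        have "misere_outcome (H + (copies n H + K)) = PPos"
          using True by (simp add: add.assoc)
        then have "misere_outcome (G' + (copies n H + K)) \<noteq> PPos"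
          if "G' \<in> fset (options G)" for G'
          using * W that by blast
        then have "\<forall>G'\<in>fset (options G). misere_outcome (copies n H + (G' + K)) \<noteq> PPos"
          by (simp add: add.left_commute)
        moreover have "\<forall>K'\<in>fset (options K). misere_outcome (copies (Suc n) H + K') \<noteq> PPos"
          using True unfolding misere_PPos_iff[of "copies (Suc n) H + K"] options_copies_plus
          by blast
        ultimately show ?thesis using PPos_iff True by simp
      next
        case False
        \<comment> \<open>The P-position supplied by (ii) violates the right side of
          \<open>PPos_iff\<close>.\<close>
        then have "misere_outcome (copies (Suc n) G + K) \<noteq> PPos"
          using * K PPos_iff by blast
        then show ?thesis using False outcome_eq_iff by blast
      qed
    qed
  qed simp
  then show ?same by blast
qed

text \<open>The left side is (a) for the class of \<open>H\<close>; its last conjunct at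
  \<open>H' = H\<close> gives the right side. Conversely, replacing \<open>G\<close> by
  \<open>H\<close> carries \<open>B\<close> into \<open>A\<close> and preserves outcomes, also when
  a test game from \<open>B\<close> is added.\<close>

lemma equiv_extension_iff:
  assumes A: "closed_games A" and G: "fset (options G) \<subseteq> A" and H: "H \<in> A"
    and B: "B = cl (A \<union> {G})"
  shows
    "(\<forall>K\<in>A. \<forall>K'\<in>A. (K, K') \<in> misere_equiv A \<longleftrightarrow> (K, K') \<in> misere_equiv B) \<and>
     (\<forall>K\<in>B. \<exists>K'\<in>A. (K, K') \<in> misere_equiv B) \<and>
     (\<forall>H'\<in>A. quot_map A H' = quot_map A H \<longrightarrow> (G, H') \<in> misere_equiv B) \<longleftrightarrow>
     (\<forall>n. \<forall>K\<in>A. misere_outcome (copies n G + K) = misere_outcome (copies n H + K))"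
    (is "?ext \<longleftrightarrow> ?same")
proof
  have ne: "A \<noteq> {}" using H by blast
  have B_eq: "B = {copies n G + K | n K. K \<in> A}"
    unfolding B using cl_insert[OF A ne G] .
  have B_closed: "closed_games B"
    unfolding B by (rule closed_games_cl)
  have AB: "A \<subseteq> B" and GB: "G \<in> B"
    unfolding B cl_def using hull_subset[of "A \<union> {G}"] by auto
  {
    assume ?ext
    then have "(G, H) \<in> misere_equiv B" using H by blast
    from misere_equiv_copies[OF B_closed this] show ?same using AB by blast
  next
    assume same: ?same
    \<comment> \<open>The \<open>n\<close> copies in the element and the \<open>m\<close> copies in
      the test game are pooled and exchanged together.\<close>
    have outcome: "misere_outcome (copies n G + K + (copies m G + L)) =
        misere_outcome (copies n H + K + (copies m H + L))" if "K \<in> A" "L \<in> A" for n K m L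
    proof -
      have "K + L \<in> A" using that closed_games_add[OF A] by blast
      then have "misere_outcome (copies (n + m) G + (K + L)) =
          misere_outcome (copies (n + m) H + (K + L))"
        using same by blast
      then show ?thesis by (simp add: copies_add ac_simps)
    qed
    have outcome0: "misere_outcome (K + (copies m G + L)) =
        misere_outcome (K + (copies m H + L))" if "K \<in> A" "L \<in> A" for K m L
      using outcome[OF that, of 0 m] by simp
    have HA: "copies n H + K \<in> A" if "K \<in> A" for n K
      using that copies_in_closed[OF A H] closed_games_add[OF A] by blast
    \<comment> \<open>A test game \<open>copies m G + X\<close> of \<open>B\<close> is traded for
      \<open>copies m H + X\<close>, which lies in \<open>A\<close>, where \<open>eq\<close>
      applies.\<close>
    have lift: "(copies n G + K, L) \<in> misere_equiv B"
      if "K \<in> A" "L \<in> A" and eq: "(copies n H + K, L) \<in> misere_equiv A" for n K L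
    proof -
      have "misere_outcome (copies n G + K + (copies m G + X)) =
          misere_outcome (L + (copies m G + X))" if "X \<in> A" for m X
        using outcome[OF \<open>K \<in> A\<close> that] outcome0[OF \<open>L \<in> A\<close> that] eq HA[OF that]
        by (simp add: misere_equiv_def)
      then show ?thesis
        using that AB unfolding misere_equiv_def B_eq by blast
    qed
    have refl: "(K, K) \<in> misere_equiv A" if "K \<in> A" for K
      using that by (simp add: misere_equiv_def)
    \<comment> \<open>One direction is \<open>lift\<close> with no copies of \<open>G\<close>; the
      other restricts the test games from \<open>B\<close> to \<open>A\<close>.\<close>
    have "(K, K') \<in> misere_equiv A \<longleftrightarrow> (K, K') \<in> misere_equiv B"
      if "K \<in> A" "K' \<in> A" for K K'
      using lift[of K K' 0] that AB by (auto simp: misere_equiv_def)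
    \<comment> \<open>The witness for \<open>copies n G + K\<close> is
      \<open>copies n H + K\<close>.\<close>
    moreover have "\<exists>K'\<in>A. (K, K') \<in> misere_equiv B" if "K \<in> B" for K
      using that lift HA refl unfolding B_eq by blast
    moreover have "(G, H') \<in> misere_equiv B" if "H' \<in> A" "quot_map A H' = quot_map A H" for H'
    proof -
      have "(H, H') \<in> misere_equiv A" using quot_map_eq_iff that H by metis
      then show ?thesis
        using lift[of 0 H' "Suc 0"] zero_in_closed[OF A ne] that by simp
    qed
    ultimately show ?ext by blast
  }
qed

section \<open>Translation from the quotient to representatives\<close>

theorem theorem5p7:
  fixes A B :: "game set" and G :: game and x :: "game set"
  assumes "closed_games A"
    and "options G \<noteq> {||}"
    and "fset (options G) \<subseteq> A"
    and "B = cl (A \<union> {G})"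
    and "x \<in> carrier (misere_quotient A)"
  shows
    "((\<forall>K\<in>A. \<forall>K'\<in>A. (K, K') \<in> misere_equiv A \<longleftrightarrow> (K, K') \<in> misere_equiv B) \<and>
      (\<forall>K\<in>B. \<exists>K'\<in>A. (K, K') \<in> misere_equiv B) \<and>
      (\<forall>H\<in>A. quot_map A H = x \<longrightarrow> (G, H) \<in> misere_equiv B))
     \<longleftrightarrow>
     (option_classes A G \<subseteq> meximal_set A x \<and>
      (\<forall>(y, E) \<in> transition_algebra A. \<forall>n::nat.
         x [^]\<^bsub>misere_quotient A\<^esub> (n + 1) \<otimes>\<^bsub>misere_quotient A\<^esub> y \<notin> P_portion A \<longrightarrow>
           (\<exists>y'\<in>E. x [^]\<^bsub>misere_quotient A\<^esub> (n + 1) \<otimes>\<^bsub>misere_quotient A\<^esub> y' \<in> P_portion A) \<or>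
           (\<exists>x'\<in>option_classes A G.
              x [^]\<^bsub>misere_quotient A\<^esub> n \<otimes>\<^bsub>misere_quotient A\<^esub> x' \<otimes>\<^bsub>misere_quotient A\<^esub> y
                \<in> P_portion A)))"
proof -
  let ?Q = "misere_quotient A"
  obtain H where H: "H \<in> A" and x: "x = quot_map A H"
    using assms(5) by (auto simp: carrier_misere_quotient)
  note A = assms(1) and ne = assms(2) and G = assms(3)
  note add = closed_games_add[OF A] and cop = copies_in_closed[OF A H]
  note P_iff = quot_map_in_P_portion[OF A] and mult = mult_quot_map[OF A]
  \<comment> \<open>Products and powers are computed on representatives, so membership in
    \<open>P_portion A\<close> becomes a statement about outcomes.\<close>
  have pow: "x [^]\<^bsub>?Q\<^esub> (n + 1) \<otimes>\<^bsub>?Q\<^esub> quot_map A K \<in> P_portion A \<longleftrightarrow>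
      misere_outcome (copies (Suc n) H + K) = PPos" if "K \<in> A" for n K
    unfolding x quot_map_pow[OF A H] mult[OF cop that] P_iff[OF add[OF cop that]] by simp
  have pow': "x [^]\<^bsub>?Q\<^esub> n \<otimes>\<^bsub>?Q\<^esub> quot_map A G' \<otimes>\<^bsub>?Q\<^esub> quot_map A K \<in> P_portion A \<longleftrightarrow>
      misere_outcome (copies n H + (G' + K)) = PPos" if "G' \<in> A" "K \<in> A" for n G' K
    unfolding x quot_map_pow[OF A H] mult[OF cop that(1)]
      mult[OF add[OF cop that(1)] that(2)] P_iff[OF add[OF add[OF cop that(1)] that(2)]]
    by (simp add: add.assoc)
  have mex: "option_classes A G \<subseteq> meximal_set A x \<longleftrightarrow>
      (\<forall>G'\<in>fset (options G). \<forall>W\<in>A.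
         misere_outcome (H + W) = PPos \<longrightarrow> misere_outcome (G' + W) \<noteq> PPos)"
  proof -
    have "quot_map A G' \<in> meximal_set A x \<longleftrightarrow>
        (\<forall>W\<in>A. misere_outcome (H + W) = PPos \<longrightarrow> misere_outcome (G' + W) \<noteq> PPos)"
      if "G' \<in> A" for G'
      using that H by (auto simp: meximal_set_def carrier_misere_quotient x mult P_iff add)
    then show ?thesis
      using G unfolding option_classes_def by blast
  qed
  have move: "(\<forall>(y, E) \<in> transition_algebra A. \<forall>n::nat.
         x [^]\<^bsub>?Q\<^esub> (n + 1) \<otimes>\<^bsub>?Q\<^esub> y \<notin> P_portion A \<longrightarrow>
           (\<exists>y'\<in>E. x [^]\<^bsub>?Q\<^esub> (n + 1) \<otimes>\<^bsub>?Q\<^esub> y' \<in> P_portion A) \<or>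
           (\<exists>x'\<in>option_classes A G. x [^]\<^bsub>?Q\<^esub> n \<otimes>\<^bsub>?Q\<^esub> x' \<otimes>\<^bsub>?Q\<^esub> y \<in> P_portion A)) \<longleftrightarrow>
      (\<forall>K\<in>A. \<forall>n. misere_outcome (copies (Suc n) H + K) \<noteq> PPos \<longrightarrow>
        (\<exists>K'\<in>fset (options K). misere_outcome (copies (Suc n) H + K') = PPos) \<or>
        (\<exists>G'\<in>fset (options G). misere_outcome (copies n H + (G' + K)) = PPos))"
    (is "?lhs \<longleftrightarrow> ?rhs")
  proof -
    \<comment> \<open>The pairs of the transition algebra are indexed by \<open>K\<close> in
      \<open>A\<close>, and the elements of \<open>E\<close> by the options of that same
      \<open>K\<close>.\<close>
    have "?lhs \<longleftrightarrow> (\<forall>K\<in>A. \<forall>n::nat.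
        x [^]\<^bsub>?Q\<^esub> (n + 1) \<otimes>\<^bsub>?Q\<^esub> quot_map A K \<notin> P_portion A \<longrightarrow>
        (\<exists>K'\<in>fset (options K). x [^]\<^bsub>?Q\<^esub> (n + 1) \<otimes>\<^bsub>?Q\<^esub> quot_map A K' \<in> P_portion A) \<or>
        (\<exists>G'\<in>fset (options G).
           x [^]\<^bsub>?Q\<^esub> n \<otimes>\<^bsub>?Q\<^esub> quot_map A G' \<otimes>\<^bsub>?Q\<^esub> quot_map A K \<in> P_portion A))"
      by (simp add: transition_algebra_def option_classes_def Setcompr_eq_image)
    also have "\<dots> \<longleftrightarrow> ?rhs"
    proof (intro ball_cong refl all_cong1 imp_cong disj_cong bex_cong)
    qed (use pow pow' G closed_games_option[OF A] in blast)+
    finally show ?thesis .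
  qed
  show ?thesis
    unfolding mex move same_outcome_iff[OF A ne G H, symmetric]
    unfolding x by (rule equiv_extension_iff[OF A G H assms(4)])
qed

end
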